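(* Let $n\ge2$ be an integer, $a_0,\dots,a_{n+1}\in\mathbb{C}$, and $H(x,y)=xy+H_{n+1}(x,y)$ with $H_{n+1}(x,y)=\sum_{j=0}^{n+1}a_jx^{n+1-j}y^j$. Consider the Hamiltonian system $\frac{dx}{dt}=H_y(x,y)$, $\frac{dy}{dt}=-H_x(x,y)$ on $\mathbb{C}^2$. If $a_ja_k\neq0$ for two integers $j,k$ such that $0\le j<\frac{n+1}{2}<k\le n+1$, then for every $h\neq0$ the period $1$-form $\omega=\frac{dx}{H_y(x,y)}$ restricted to $\overline{L}_h$ does not have any pole at infinity.
   Context: $L_h=\{(x,y)\in\mathbb{C}^2:H(x,y)=h\}$ and $\overline{L}_h$ is its projective closure in $\mathbb{CP}^2$ (with homogeneous coordinates $[x:y:z]$), given by $z^{n-1}xy+H_{n+1}(x,y)-hz^{n+1}=0$. Points at infinity are the points of $\overline{L}_h$ with $z=0$. That $\omega$ has no pole at infinity means that on every local branch of $\overline{L}_h$ at every point at infinity, the pull-back of $\omega$ by a (Puiseux) parameterization $s\mapsto(x(s),y(s))$ of this branch is a $1$-form in $s$ that is holomorphic at $s=0$. *)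

theory Defs
  imports "HOL-Complex_Analysis.Complex_Analysis"
begin

definition Hom :: "nat \<Rightarrow> (nat \<Rightarrow> complex) \<Rightarrow> complex \<Rightarrow> complex \<Rightarrow> complex" where
  "Hom n a x y = (\<Sum>j=0..n+1. a j * x ^ (n + 1 - j) * y ^ j)"

definition Ham :: "nat \<Rightarrow> (nat \<Rightarrow> complex) \<Rightarrow> complex \<Rightarrow> complex \<Rightarrow> complex" where
  "Ham n a x y = x * y + Hom n a x y"

definition Ham_y :: "nat \<Rightarrow> (nat \<Rightarrow> complex) \<Rightarrow> complex \<Rightarrow> complex \<Rightarrow> complex" where
  "Ham_y n a x y = deriv (\<lambda>v. Ham n a x v) y"

definition level_curve :: "nat \<Rightarrow> (nat \<Rightarrow> complex) \<Rightarrow> complex \<Rightarrow> (complex \<times> complex) set" where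
  "level_curve n a h = {(x, y). Ham n a x y = h}"

text \<open>The point \<open>[x:y:z]\<close> of the complex projective plane is represented by the set of all its
  homogeneous coordinate vectors; it is a point only when \<open>(x, y, z)\<close> is not the zero vector.\<close>

type_synonym proj_pt = "(complex \<times> complex \<times> complex) set"

definition proj :: "complex \<Rightarrow> complex \<Rightarrow> complex \<Rightarrow> proj_pt" where
  "proj x y z = {(c * x, c * y, c * z) | c. c \<noteq> 0}"

definition proj_closure :: "nat \<Rightarrow> (nat \<Rightarrow> complex) \<Rightarrow> complex \<Rightarrow> proj_pt set" where
  "proj_closure n a h = {proj x y z | x y z. (x, y, z) \<noteq> (0, 0, 0) \<and>
     z ^ (n - 1) * x * y + Hom n a x y - h * z ^ (n + 1) = 0}"

definition points_at_infinity :: "proj_pt set \<Rightarrow> proj_pt set" where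
  "points_at_infinity C = {P \<in> C. \<exists>x y. P = proj x y 0}"

text \<open>A parameterization of a local branch of \<open>C\<close> at \<open>P\<close> is a germ at \<open>0\<close> of an injective
  holomorphic map \<open>s \<mapsto> [X s : Y s : Z s]\<close> into \<open>C\<close> that sends \<open>0\<close> to \<open>P\<close>. A Puiseux
  parameterization (one affine coordinate being a power of \<open>s\<close>, with minimal exponent) is of this
  kind, and two such germs for the same branch differ by a biholomorphic change of \<open>s\<close>.
  Since elements of \<open>C\<close> are actual projective points, \<open>X\<close>, \<open>Y\<close>, \<open>Z\<close> have no common zero.\<close>

definition branch_param ::
  "proj_pt set \<Rightarrow> proj_pt \<Rightarrow> (complex \<Rightarrow> complex) \<Rightarrow> (complex \<Rightarrow> complex) \<Rightarrow> (complex \<Rightarrow> complex) \<Rightarrow> bool"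
where
  "branch_param C P X Y Z \<longleftrightarrow>
     X analytic_on {0} \<and> Y analytic_on {0} \<and> Z analytic_on {0} \<and>
     proj (X 0) (Y 0) (Z 0) = P \<and>
     (\<exists>r>0. (\<forall>s\<in>ball 0 r. proj (X s) (Y s) (Z s) \<in> C) \<and>
            inj_on (\<lambda>s. proj (X s) (Y s) (Z s)) (ball 0 r))"

text \<open>The pull-back of the form \<open>dx / G(x,y)\<close> by \<open>s \<mapsto> (x s, y s)\<close> is
  \<open>x'(s) / G(x s, y s) ds\<close>. Requiring the denominator to be nonzero near \<open>0\<close> excludes
  values produced by the convention \<open>u / 0 = 0\<close>.\<close>

definition dx_over_pullback_holomorphic ::
  "(complex \<Rightarrow> complex \<Rightarrow> complex) \<Rightarrow> (complex \<Rightarrow> complex) \<Rightarrow> (complex \<Rightarrow> complex) \<Rightarrow> bool"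
where
  "dx_over_pullback_holomorphic G x y \<longleftrightarrow>
     (\<exists>g. g analytic_on {0} \<and>
        (\<forall>\<^sub>F s in at 0. G (x s) (y s) \<noteq> 0 \<and> deriv x s / G (x s) (y s) = g s))"

text \<open>The condition on \<open>Z\<close> says that the affine coordinates \<open>x = X / Z\<close> and \<open>y = Y / Z\<close> are
  genuinely defined away from \<open>s = 0\<close>.\<close>

definition no_pole_at_infinity :: "(complex \<Rightarrow> complex \<Rightarrow> complex) \<Rightarrow> proj_pt set \<Rightarrow> bool" where
  "no_pole_at_infinity G C \<longleftrightarrow>
     (\<forall>P\<in>points_at_infinity C. \<forall>X Y Z. branch_param C P X Y Z \<longrightarrow>
        (\<forall>\<^sub>F s in at 0. Z s \<noteq> 0) \<and>
        dx_over_pullback_holomorphic G (\<lambda>s. X s / Z s) (\<lambda>s. Y s / Z s))"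

text \<open>The affine part of the projective closure is the level curve.\<close>

lemma proj_affine_in_proj_closure_iff:
  assumes "n \<ge> 1"
  shows "proj x y 1 \<in> proj_closure n a h \<longleftrightarrow> (x, y) \<in> level_curve n a h"
proof
  assume "(x, y) \<in> level_curve n a h"
  then show "proj x y 1 \<in> proj_closure n a h"
    unfolding level_curve_def proj_closure_def Ham_def
    by (intro CollectI exI[of _ x] exI[of _ y] exI[of _ 1]) auto
next
  assume "proj x y 1 \<in> proj_closure n a h"
  then obtain u v w where eq: "proj x y 1 = proj u v w"
    and F: "w ^ (n - 1) * u * v + Hom n a u v - h * w ^ (n + 1) = 0"
    unfolding proj_closure_def by blast
  have "(u, v, w) \<in> proj u v w"
    unfolding proj_def by (intro CollectI exI[of _ 1]) simp
  then obtain c where c: "c \<noteq> 0" "u = c * x" "v = c * y" "w = c"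
    using eq[symmetric] unfolding proj_def by auto
  have "Hom n a u v = c ^ (n + 1) * Hom n a x y"
    unfolding Hom_def sum_distrib_left
  proof (rule sum.cong)
    fix j assume "j \<in> {0..n+1}"
    then have "c ^ (n + 1) = c ^ (n + 1 - j) * c ^ j"
      by (simp flip: power_add)
    then show "a j * u ^ (n + 1 - j) * v ^ j = c ^ (n + 1) * (a j * x ^ (n + 1 - j) * y ^ j)"
      by (simp add: c power_mult_distrib)
  qed simp
  moreover have "c ^ (n + 1) = c ^ (n - 1) * c * c"
    using assms by (cases n) auto
  then have "w ^ (n - 1) * u * v = c ^ (n + 1) * (x * y)"
    by (simp add: c)
  ultimately have "c ^ (n + 1) * (x * y + Hom n a x y - h) = 0"
    using F c(4) by (simp add: algebra_simps)
  then show "(x, y) \<in> level_curve n a h"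
    using c(1) by (simp add: level_curve_def Ham_def)
qed

end

theory Submission
  imports Defs
begin

text \<open>
  On the level curve \<open>H = h\<close> one has \<open>H\<^sub>x dx + H\<^sub>y dy = 0\<close>, hence
  \<open>H\<^sub>y (x dy - y dx) = - (x H\<^sub>x + y H\<^sub>y) dx\<close>. Euler's identity, applied to the parts of degree \<open>2\<close>
  and \<open>n + 1\<close> of \<open>H\<close>, and \<open>H = h\<close> give
  \<open>x H\<^sub>x + y H\<^sub>y = 2 x y + (n + 1) (h - x y) = (n + 1) h - (n - 1) x y\<close>. In homogeneous
  coordinates the period form is therefore
  \<open>\<omega> = (X dY - Y dX) / ((n - 1) X Y - (n + 1) h Z\<^sup>2)\<close>, where the derivatives of \<open>H\<close>, and with them
  the multiplicities of the roots of \<open>H\<^sub>n\<^sub>+\<^sub>1\<close>, have disappeared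
  (lemma \<open>Ham_y_times_wronskian\<close>).

  At a point at infinity with \<open>X Y \<noteq> 0\<close> the denominator does not vanish and \<open>\<omega>\<close> is holomorphic.
  The other candidates are \<open>[1:0:0]\<close> and \<open>[0:1:0]\<close>, which the exchange of \<open>x\<close> and \<open>y\<close> swaps
  while changing the sign of \<open>\<omega>\<close>. At \<open>[1:0:0]\<close> put \<open>w = Y / X\<close>, \<open>\<zeta> = Z / X\<close>; then
  \<open>\<omega> = dw / ((n - 1) w - (n + 1) h \<zeta>\<^sup>2)\<close>. If \<open>j\<close> is the least index with \<open>a\<^sub>j \<noteq> 0\<close>, the equation of the
  curve reads \<open>u\<^sup>j Q(w) = \<zeta>\<^sup>n\<^sup>+\<^sup>1\<^sup>-\<^sup>2\<^sup>j (h - u)\<close> for \<open>u = w / \<zeta>\<^sup>2\<close>, with \<open>Q(0) = a\<^sub>j\<close>, and since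
  \<open>2 j < n + 1\<close> it forces \<open>u \<rightarrow> 0\<close> (lemma \<open>quotient_by_square_tendsto_0\<close>). So the denominator is
  \<open>\<zeta>\<^sup>2\<close> times a unit, while \<open>dw / \<zeta>\<^sup>2 = 2 u d\<zeta> / \<zeta> + du\<close> is holomorphic, because \<open>u\<close> vanishes at
  the point and cancels the simple pole of \<open>d\<zeta> / \<zeta>\<close> (lemma \<open>euler_form_analytic\<close>). The index
  \<open>k > (n + 1) / 2\<close> does the same for \<open>[0:1:0]\<close>.

  It remains to see that the quotients are genuine. \<open>Z\<close> cannot vanish identically on a branch, as
  the line at infinity meets the curve in finitely many points. If \<open>H\<^sub>y\<close> vanished identically on
  a branch, the identity above would give \<open>dx = 0\<close>, so \<open>x\<close> would be a nonzero constant and the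
  branch would sit at \<open>[0:1:0]\<close>; but there \<open>x y = X Y / Z\<^sup>2\<close> tends to \<open>0\<close> while \<open>y\<close> tends to
  infinity (lemma \<open>Ham_y_nonzero_on_germ\<close>).
\<close>

section \<open>The homogeneous equation of the curve\<close>

definition proj_poly :: "nat \<Rightarrow> (nat \<Rightarrow> complex) \<Rightarrow> complex \<Rightarrow> complex \<Rightarrow> complex \<Rightarrow> complex \<Rightarrow> complex" where
  "proj_poly n a h x y z = z ^ (n - 1) * x * y + Hom n a x y - h * z ^ (n + 1)"

lemma Hom_scale: "Hom n a (c * x) (c * y) = c ^ (n + 1) * Hom n a x y"
  unfolding Hom_def sum_distrib_left
proof (rule sum.cong)
  fix j assume "j \<in> {0..n+1}"
  then have "c ^ (n + 1) = c ^ (n + 1 - j) * c ^ j"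
    by (simp flip: power_add)
  then show "a j * (c * x) ^ (n + 1 - j) * (c * y) ^ j = c ^ (n + 1) * (a j * x ^ (n + 1 - j) * y ^ j)"
    by (simp add: power_mult_distrib)
qed simp

lemma Hom_swap: "Hom n (\<lambda>i. a (n + 1 - i)) y x = Hom n a x y"
proof -
  have "Hom n a x y = (\<Sum>j=0..n+1. a (n + 1 - j) * x ^ (n + 1 - (n + 1 - j)) * y ^ (n + 1 - j))"
    unfolding Hom_def by (subst sum.atLeastAtMost_rev) simp
  also have "\<dots> = Hom n (\<lambda>i. a (n + 1 - i)) y x"
    unfolding Hom_def by (intro sum.cong) auto
  finally show ?thesis ..
qed

lemma proj_poly_scale:
  assumes "n \<ge> 1"
  shows "proj_poly n a h (c * x) (c * y) (c * z) = c ^ (n + 1) * proj_poly n a h x y z"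
proof -
  obtain m where "n = Suc m"
    using assms by (cases n) auto
  then show ?thesis
    unfolding proj_poly_def Hom_scale by (simp add: power_mult_distrib algebra_simps)
qed

lemma proj_poly_swap: "proj_poly n (\<lambda>i. a (n + 1 - i)) h y x z = proj_poly n a h x y z"
  unfolding proj_poly_def Hom_swap by simp

lemma self_in_proj: "(x, y, z) \<in> proj x y z"
  unfolding proj_def by (intro CollectI exI[of _ 1]) simp

lemma proj_eqD:
  assumes "proj x y z = proj u v w"
  obtains c where "c \<noteq> 0" "x = c * u" "y = c * v" "z = c * w"
  using assms self_in_proj[of x y z] unfolding proj_def by auto

lemma proj_scale:
  assumes "c \<noteq> 0"
  shows "proj (c * x) (c * y) (c * z) = proj x y z"
proof (intro set_eqI iffI)
  fix p assume "p \<in> proj (c * x) (c * y) (c * z)"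
  then obtain d where "d \<noteq> 0" "p = (d * (c * x), d * (c * y), d * (c * z))"
    unfolding proj_def by auto
  then show "p \<in> proj x y z"
    unfolding proj_def using assms by (intro CollectI exI[of _ "d * c"]) (simp add: mult.assoc)
next
  fix p assume "p \<in> proj x y z"
  then obtain d where "d \<noteq> 0" "p = (d * x, d * y, d * z)"
    unfolding proj_def by auto
  then show "p \<in> proj (c * x) (c * y) (c * z)"
    unfolding proj_def using assms by (intro CollectI exI[of _ "d / c"]) simp
qed

text \<open>The closure is a set of points, each given by some vector of coordinates; by homogeneity
  the equation then holds for every vector representing the point.\<close>

lemma proj_in_closureD:
  assumes "n \<ge> 1" "proj x y z \<in> proj_closure n a h"
  shows "(x, y, z) \<noteq> (0, 0, 0)" "proj_poly n a h x y z = 0"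
proof -
  from assms(2) obtain u v w where e: "proj x y z = proj u v w" and nz: "(u, v, w) \<noteq> (0, 0, 0)"
    and F: "proj_poly n a h u v w = 0"
    unfolding proj_closure_def proj_poly_def by blast
  from e obtain c where c: "c \<noteq> 0" "x = c * u" "y = c * v" "z = c * w"
    by (rule proj_eqD)
  show "(x, y, z) \<noteq> (0, 0, 0)"
    using c nz by auto
  show "proj_poly n a h x y z = 0"
    unfolding c proj_poly_scale[OF assms(1)] F by simp
qed

section \<open>Germs of analytic functions\<close>

lemma analytic_zero_or_nonzero:
  assumes "f analytic_on {z}"
  shows "(\<forall>\<^sub>F s in at z. f s \<noteq> 0) \<or> (\<forall>\<^sub>F s in at z. f s = 0)"
  using not_essential_frequently_0_imp_eventually_0[of f z] assms
  by (auto simp: isolated_singularity_at_analytic not_essential_analytic frequently_def)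

text \<open>The logarithmic derivative of \<open>f\<close> has at most a simple pole, which a zero of \<open>u\<close> cancels.\<close>

lemma times_log_deriv_analytic:
  fixes f u :: "complex \<Rightarrow> complex"
  assumes f: "f analytic_on {z}" and nz: "\<forall>\<^sub>F s in at z. f s \<noteq> 0"
    and u: "u analytic_on {z}" "u z = 0"
  obtains g where "g analytic_on {z}" "\<forall>\<^sub>F s in at z. deriv f s / f s * u s = g s"
proof -
  have fs: "isolated_singularity_at f z" "not_essential f z"
    using f by (simp_all add: isolated_singularity_at_analytic not_essential_analytic)
  have "\<exists>\<^sub>F s in at z. f s \<noteq> 0"
    using nz by (simp add: eventually_frequently)
  from zorder_exist[OF fs this] obtain q r m where q: "q z \<noteq> 0" "r > 0" "q holomorphic_on cball z r"
    and fq: "\<And>s. s \<in> cball z r - {z} \<Longrightarrow> f s = q s * (s - z) powi m \<and> q s \<noteq> 0"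
    by metis
  have qan: "q analytic_on ball z r"
    using q(3) by (meson analytic_on_holomorphic ball_subset_cball holomorphic_on_subset open_ball analytic_on_open)
  have qz: "q analytic_on {z}"
    using qan q(2) by (meson analytic_on_subset centre_in_ball empty_subsetI insert_subset)
  have near: "\<forall>\<^sub>F s in at z. s \<in> ball z r - {z}"
    using q(2) by (intro eventually_at_in_open) auto
  \<comment> \<open>\<open>m\<close> is the order of \<open>f\<close> at \<open>z\<close>, i.e. the residue of \<open>f' / f\<close>.\<close>
  have ld: "(s - z) * (deriv f s / f s) = of_int m + (s - z) * (deriv q s / q s)"
    if s: "s \<in> ball z r - {z}" for s
  proof -
    have qd: "(q has_field_derivative deriv q s) (at s)"
      using qan s by (intro analytic_derivI) (auto intro: analytic_on_subset)
    have "((\<lambda>s. q s * (s - z) powi m) has_field_derivative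
        (deriv q s * (s - z) powi m + of_int m * (s - z) powi (m - 1) * q s)) (at s)"
      using s by (auto intro!: derivative_eq_intros qd)
    then have "(f has_field_derivative
        (deriv q s * (s - z) powi m + of_int m * (s - z) powi (m - 1) * q s)) (at s)"
      by (rule has_field_derivative_transform_within_open[of _ _ _ "ball z r - {z}"])
        (use s fq in \<open>auto intro: open_delete\<close>)
    then have df: "deriv f s = deriv q s * (s - z) powi m + of_int m * (s - z) powi (m - 1) * q s"
      by (rule DERIV_imp_deriv)
    define p t where "p = (s - z) powi (m - 1)" and "t = s - z"
    have "deriv f s = deriv q s * (p * t) + of_int m * p * q s"
        "f s = q s * (p * t)" "q s \<noteq> 0" "p \<noteq> 0" "t \<noteq> 0"
      using df fq[of s] s by (auto simp: p_def t_def power_int_diff)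
    then have "t * (deriv f s / f s) = of_int m + t * (deriv q s / q s)"
      by (simp add: field_simps)
    then show ?thesis
      by (simp add: t_def)
  qed
  define c where "c = of_int m * deriv u z"
  let ?F = "\<lambda>s. deriv f s / f s * u s"
  have "isolated_singularity_at ?F z"
    using fs f u by (intro singularity_intros)
      (auto intro!: isolated_singularity_at_analytic not_essential_analytic analytic_intros)
  moreover have "?F \<midarrow>z\<rightarrow> c"
  proof -
    have "((\<lambda>s. (s - z) * (deriv q s / q s)) \<longlongrightarrow> (z - z) * (deriv q z / q z)) (at z)"
      using qz q(1) by (intro tendsto_intros isContD analytic_at_imp_isCont analytic_intros)
    moreover have "((\<lambda>s. (u s - u z) / (s - z)) \<longlongrightarrow> deriv u z) (at z)"
      using analytic_derivI[OF u(1), of UNIV] by (simp add: has_field_derivative_iff)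
    ultimately have "((\<lambda>s. (of_int m + (s - z) * (deriv q s / q s)) * (u s / (s - z))) \<longlongrightarrow>
        (of_int m + 0) * deriv u z) (at z)"
      using u(2) by (intro tendsto_intros) auto
    moreover have "\<forall>\<^sub>F s in at z. (of_int m + (s - z) * (deriv q s / q s)) * (u s / (s - z)) = ?F s"
      using near
    proof eventually_elim
      case (elim s)
      then show ?case
        unfolding ld[OF elim, symmetric] by simp
    qed
    ultimately have "?F \<midarrow>z\<rightarrow> (of_int m + 0) * deriv u z"
      by (rule Lim_transform_eventually)
    then show ?thesis
      by (simp add: c_def)
  qed
  ultimately have "(\<lambda>s. if s = z then c else ?F s) analytic_on {z}"
    by (rule removable_singularity')
  moreover have "\<forall>\<^sub>F s in at z. ?F s = (if s = z then c else ?F s)"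
    by (auto simp: eventually_at_filter)
  ultimately show ?thesis
    using that by blast
qed

lemma eventually_at_of_nhds: "\<forall>\<^sub>F s in nhds z. P s \<Longrightarrow> \<forall>\<^sub>F s in at z. P s"
  by (simp add: eventually_nhds_conv_at)

lemma eventually_at_eventually_nhds:
  fixes z :: "'b :: t1_space"
  assumes "\<forall>\<^sub>F s in at z. P s"
  shows "\<forall>\<^sub>F s in at z. \<forall>\<^sub>F t in nhds s. P t"
proof -
  have "\<forall>\<^sub>F s in nhds z. \<forall>\<^sub>F t in nhds s. t \<noteq> z \<longrightarrow> P t"
    using assms by (simp add: eventually_eventually eventually_at_filter)
  then have "\<forall>\<^sub>F s in at z. \<forall>\<^sub>F t in nhds s. t \<noteq> z \<longrightarrow> P t"
    by (rule eventually_at_of_nhds)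
  with eventually_neq_at_within[of z z UNIV] show ?thesis
  proof eventually_elim
    case (elim s)
    with t1_space_nhds[of s z] show ?case
      by (auto elim: eventually_elim2)
  qed
qed

lemma eventually_analytic_at:
  assumes "f analytic_on {z}"
  shows "\<forall>\<^sub>F s in nhds z. f analytic_on {s}"
proof -
  obtain r where r: "r > 0" "f holomorphic_on ball z r"
    using assms by (auto simp: analytic_at_ball)
  then have "\<forall>\<^sub>F s in nhds z. s \<in> ball z r"
    by (intro eventually_nhds_in_open) auto
  then show ?thesis
    by eventually_elim (use r in \<open>auto simp: analytic_at\<close>)
qed

lemma eventually_deriv_zero_imp_constant:
  fixes f :: "complex \<Rightarrow> complex"
  assumes "\<forall>\<^sub>F s in at z. f analytic_on {s} \<and> deriv f s = 0"
  obtains c where "\<forall>\<^sub>F s in at z. f s = c"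
proof -
  obtain d where d: "d > 0" "\<And>s. s \<in> ball z d - {z} \<Longrightarrow> f analytic_on {s} \<and> deriv f s = 0"
    using assms by (auto simp: eventually_at dist_commute)
  have "f constant_on ball z d - {z}"
  proof (rule has_field_derivative_0_imp_constant_on)
    show "(f has_field_derivative 0) (at s)" if "s \<in> ball z d - {z}" for s
      using analytic_derivI[of f s UNIV] d(2)[OF that] by simp
    show "connected (ball z d - {z})"
      by (simp add: connected_punctured_ball)
  qed (simp add: open_delete)
  then obtain c where c: "\<And>s. s \<in> ball z d - {z} \<Longrightarrow> f s = c"
    by (auto simp: constant_on_def)
  have "\<forall>\<^sub>F s in at z. s \<in> ball z d - {z}"
    using d(1) by (intro eventually_at_in_open) auto
  then show thesis
    by (intro that[of c]) (erule eventually_mono, rule c)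
qed

section \<open>Branches of the projective curve at infinity\<close>

text \<open>A branch at infinity described by its coordinates alone: the requirement that
  \<open>(X 0, Y 0, 0)\<close> be a point and the equation replace the mention of the closure, which makes the
  exchange of \<open>x\<close> and \<open>y\<close> available.\<close>

definition curve_germ ::
  "nat \<Rightarrow> (nat \<Rightarrow> complex) \<Rightarrow> complex \<Rightarrow> (complex \<Rightarrow> complex) \<Rightarrow> (complex \<Rightarrow> complex) \<Rightarrow> (complex \<Rightarrow> complex) \<Rightarrow> bool"
where
  "curve_germ n a h X Y Z \<longleftrightarrow>
     X analytic_on {0} \<and> Y analytic_on {0} \<and> Z analytic_on {0} \<and>
     Z 0 = 0 \<and> (X 0 \<noteq> 0 \<or> Y 0 \<noteq> 0) \<and>
     (\<exists>r>0. (\<forall>s\<in>ball 0 r. proj_poly n a h (X s) (Y s) (Z s) = 0) \<and>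
            inj_on (\<lambda>s. proj (X s) (Y s) (Z s)) (ball 0 r))"

lemma curve_germ_swap:
  assumes "curve_germ n a h X Y Z"
  shows "curve_germ n (\<lambda>i. a (n + 1 - i)) h Y X Z"
proof -
  have eq: "proj x y z = proj u v w" if swapped: "proj y x z = proj v u w" for x y z u v w
  proof -
    obtain c where "c \<noteq> 0" "y = c * v" "x = c * u" "z = c * w"
      by (rule proj_eqD[OF swapped]) blast
    then show ?thesis
      by (simp add: proj_scale)
  qed
  obtain r where r: "r > 0" "\<forall>s\<in>ball 0 r. proj_poly n a h (X s) (Y s) (Z s) = 0"
    and inj: "inj_on (\<lambda>s. proj (X s) (Y s) (Z s)) (ball 0 r)"
    using assms unfolding curve_germ_def by blast
  have "inj_on (\<lambda>s. proj (Y s) (X s) (Z s)) (ball 0 r)"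
    using inj by (auto simp: inj_on_def dest: eq)
  moreover have "\<forall>s\<in>ball 0 r. proj_poly n (\<lambda>i. a (n + 1 - i)) h (Y s) (X s) (Z s) = 0"
    unfolding proj_poly_swap[of n a h] by (rule r(2))
  ultimately show ?thesis
    using assms r(1) unfolding curve_germ_def by blast
qed

lemma branch_param_curve_germ:
  assumes "n \<ge> 1" "P \<in> points_at_infinity (proj_closure n a h)"
    "branch_param (proj_closure n a h) P X Y Z"
  shows "curve_germ n a h X Y Z"
proof -
  obtain x y where "proj (X 0) (Y 0) (Z 0) = proj x y 0"
    using assms(2,3) unfolding points_at_infinity_def branch_param_def by auto
  then have Z0: "Z 0 = 0"
    by (elim proj_eqD) simp
  have "proj (X 0) (Y 0) (Z 0) \<in> proj_closure n a h"
    using assms(2,3) unfolding points_at_infinity_def branch_param_def by auto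
  from proj_in_closureD(1)[OF assms(1) this] have "X 0 \<noteq> 0 \<or> Y 0 \<noteq> 0"
    using Z0 by simp
  moreover obtain r where "r > 0" "\<forall>s\<in>ball 0 r. proj (X s) (Y s) (Z s) \<in> proj_closure n a h"
    "inj_on (\<lambda>s. proj (X s) (Y s) (Z s)) (ball 0 r)"
    using assms(3) unfolding branch_param_def by blast
  ultimately show ?thesis
    using assms(3) Z0 proj_in_closureD(2)[OF assms(1)]
    unfolding branch_param_def curve_germ_def by blast
qed

lemma dehomogenize:
  assumes "n \<ge> 1" "x \<noteq> 0" "proj_poly n a h x y z = 0"
  shows "proj_poly n a h 1 (y / x) (z / x) = 0"
  using proj_poly_scale[OF assms(1), of a h x 1 "y / x" "z / x"] assms(2,3) by simp

text \<open>If \<open>Z\<close> vanished near \<open>0\<close>, the branch would run through the points \<open>[1:w:0]\<close> with \<open>w\<close> among the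
  finitely many roots of a nonzero polynomial, against injectivity.\<close>

lemma germ_leaves_infinity:
  assumes n: "n \<ge> 2" and j: "a j \<noteq> 0" "j \<le> n + 1"
    and germ: "curve_germ n a h X Y Z" and X0: "X 0 \<noteq> 0"
  shows "\<forall>\<^sub>F s in at 0. Z s \<noteq> 0"
proof (rule ccontr)
  assume "\<not> ?thesis"
  then have "\<forall>\<^sub>F s in at 0. Z s = 0"
    using germ analytic_zero_or_nonzero[of Z 0] by (auto simp: curve_germ_def)
  then have "\<forall>\<^sub>F s in nhds 0. Z s = 0"
    using germ by (simp add: eventually_nhds_conv_at curve_germ_def)
  moreover have "\<forall>\<^sub>F s in nhds 0. X s \<noteq> 0"
    using germ X0 analytic_at_neq_imp_eventually_neq[of X 0 0]
    by (simp add: eventually_nhds_conv_at curve_germ_def)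
  ultimately have "\<forall>\<^sub>F s in nhds 0. Z s = 0 \<and> X s \<noteq> 0"
    by (rule eventually_conj)
  then obtain d where d: "d > 0" "\<And>s. s \<in> ball 0 d \<Longrightarrow> Z s = 0 \<and> X s \<noteq> 0"
    by (auto simp: eventually_nhds_metric dist_commute)
  obtain r where r: "r > 0" "\<And>s. s \<in> ball 0 r \<Longrightarrow> proj_poly n a h (X s) (Y s) (Z s) = 0"
    "inj_on (\<lambda>s. proj (X s) (Y s) (Z s)) (ball 0 r)"
    using germ unfolding curve_germ_def by auto
  define B where "B = ball (0::complex) (min d r)"
  let ?w = "\<lambda>s. Y s / X s"
  have roots: "finite {v. Hom n a 1 v = 0}"
    using polyfun_finite_roots[of a "n + 1"] j by (auto simp: Hom_def atLeast0AtMost)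
  have "?w ` B \<subseteq> {v. Hom n a 1 v = 0}"
  proof safe
    fix s assume "s \<in> B"
    then have "Z s = 0" "X s \<noteq> 0" "proj_poly n a h (X s) (Y s) (Z s) = 0"
      using d(2)[of s] r(2)[of s] by (auto simp: B_def)
    then have "proj_poly n a h 1 (?w s) 0 = 0"
      using n dehomogenize[of n "X s" a h "Y s" "Z s"] by simp_all
    then show "Hom n a 1 (?w s) = 0"
      using n by (cases n) (auto simp: proj_poly_def zero_power)
  qed
  then have "finite (?w ` B)"
    using roots finite_subset by blast
  moreover have "inj_on ?w B"
  proof (rule inj_onI)
    fix s t assume st: "s \<in> B" "t \<in> B" "?w s = ?w t"
    have "proj (X s) (Y s) (Z s) = proj 1 (?w s) 0" if "s \<in> B" for s
      using proj_scale[of "X s" 1 "?w s" 0] d(2)[of s] that by (auto simp: B_def)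
    then have "proj (X s) (Y s) (Z s) = proj (X t) (Y t) (Z t)"
      using st by simp
    then show "s = t"
      using r(3) st by (auto simp: inj_on_def B_def)
  qed
  ultimately have "finite B"
    by (rule finite_imageD)
  moreover have "open B" "B \<noteq> {}"
    using d r by (auto simp: B_def)
  ultimately show False
    using finite_imp_not_open by blast
qed

section \<open>Holomorphy of the Euler form at infinity\<close>

lemma Hom_one_factor:
  assumes "\<And>i. i < j \<Longrightarrow> a i = 0" "j \<le> n + 1"
  shows "Hom n a 1 v = v ^ j * (\<Sum>i=j..n+1. a i * v ^ (i - j))"
proof -
  have "Hom n a 1 v = (\<Sum>i=j..n+1. a i * v ^ i)"
    unfolding Hom_def using assms by (intro sum.mono_neutral_cong_right) auto
  also have "\<dots> = v ^ j * (\<Sum>i=j..n+1. a i * v ^ (i - j))"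
    unfolding sum_distrib_left by (intro sum.cong) (auto simp flip: power_add)
  finally show ?thesis .
qed

lemma Hom_one_zero: "Hom n a 1 0 = a 0"
proof -
  have "Hom n a 1 0 = (\<Sum>i\<in>{0}. a i)"
    unfolding Hom_def by (intro sum.mono_neutral_cong_right) auto
  then show ?thesis by simp
qed

text \<open>This is the estimate at \<open>[1:0:0]\<close>, where the bound \<open>2 j < n + 1\<close> enters. With
  \<open>u = w / \<zeta>\<^sup>2\<close> the equation becomes \<open>u\<^sup>j Q(w) = \<zeta>\<^sup>e (h - u)\<close>, \<open>e = n + 1 - 2 j > 0\<close>. If \<open>u\<close> stayed
  away from \<open>0\<close>, then \<open>h - u\<close> would be at most a constant multiple of \<open>u\<close>, and division by \<open>u\<close>
  would leave a left-hand side bounded below and a right-hand side tending to \<open>0\<close>. Working with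
  limits rather than orders of vanishing avoids separating the cases in which \<open>u\<close> could have a
  pole, a finite nonzero value or a zero.\<close>

lemma quotient_by_square_tendsto_0:
  fixes w \<zeta> :: "'b \<Rightarrow> complex"
  assumes w: "(w \<longlongrightarrow> 0) F" and \<zeta>: "(\<zeta> \<longlongrightarrow> 0) F" and nz: "\<forall>\<^sub>F s in F. \<zeta> s \<noteq> 0"
    and eq: "\<forall>\<^sub>F s in F. \<zeta> s ^ (n - 1) * w s + Hom n a 1 (w s) = h * \<zeta> s ^ (n + 1)"
    and j: "0 < j" "2 * j < n + 1" "a j \<noteq> 0" "\<And>i. i < j \<Longrightarrow> a i = 0"
  shows "((\<lambda>s. w s / \<zeta> s ^ 2) \<longlongrightarrow> 0) F"
proof (rule tendstoI)
  fix \<epsilon> :: real assume \<epsilon>: "\<epsilon> > 0"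
  define Q where "Q v = (\<Sum>i=j..n+1. a i * v ^ (i - j))" for v
  define e where "e = n + 1 - 2 * j"
  define C where "C = norm h / \<epsilon> + 1"
  have "((\<lambda>s. Q (w s)) \<longlongrightarrow> (\<Sum>i=j..n+1. a i * 0 ^ (i - j))) F"
    unfolding Q_def by (intro tendsto_intros w)
  also have "(\<Sum>i=j..n+1. a i * 0 ^ (i - j)) = (\<Sum>i\<in>{j}. a i * 0 ^ (i - j))"
    using j by (intro sum.mono_neutral_right) auto
  finally have Qlim: "((\<lambda>s. Q (w s)) \<longlongrightarrow> a j) F" by simp
  have "((\<lambda>s. norm (Q (w s)) * \<epsilon> ^ (j - 1) - norm (\<zeta> s) ^ e * C) \<longlongrightarrow>
      norm (a j) * \<epsilon> ^ (j - 1) - norm (0::complex) ^ e * C) F"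
    by (intro tendsto_intros Qlim \<zeta>)
  moreover have "norm (a j) * \<epsilon> ^ (j - 1) - norm (0::complex) ^ e * C > 0"
  proof -
    have "e > 0" using j by (simp add: e_def)
    then show ?thesis using j \<epsilon> by (simp add: zero_power)
  qed
  ultimately have "\<forall>\<^sub>F s in F. norm (Q (w s)) * \<epsilon> ^ (j - 1) - norm (\<zeta> s) ^ e * C > 0"
    by (rule order_tendstoD)
  with nz eq show "\<forall>\<^sub>F s in F. dist (w s / \<zeta> s ^ 2) 0 < \<epsilon>"
  proof eventually_elim
    case (elim s)
    define u where "u = w s / \<zeta> s ^ 2"
    have wu: "w s = u * \<zeta> s ^ 2"
      using elim(1) by (simp add: u_def)
    have n1: "\<zeta> s ^ (n - 1) * \<zeta> s ^ 2 = \<zeta> s ^ (n + 1)" "\<zeta> s ^ (n + 1) = \<zeta> s ^ (2 * j) * \<zeta> s ^ e"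
      using j by (simp_all add: e_def flip: power_add)
    have "\<zeta> s ^ (n - 1) * w s + w s ^ j * Q (w s) = h * \<zeta> s ^ (n + 1)"
      using elim(2) Hom_one_factor[of j a n "w s"] j by (simp add: Q_def)
    moreover have "w s ^ j = u ^ j * \<zeta> s ^ (2 * j)"
      by (simp add: wu power_mult_distrib power_mult)
    moreover have "\<zeta> s ^ (n - 1) * w s = u * (\<zeta> s ^ (2 * j) * \<zeta> s ^ e)"
      using n1 by (simp add: wu mult_ac)
    ultimately have "\<zeta> s ^ (2 * j) * (u ^ j * Q (w s)) = \<zeta> s ^ (2 * j) * (\<zeta> s ^ e * (h - u))"
      unfolding n1(2) by (simp add: algebra_simps)
    then have "u ^ j * Q (w s) = \<zeta> s ^ e * (h - u)"
      using elim(1) by simp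
    then have nrm: "norm u ^ j * norm (Q (w s)) \<le> norm (\<zeta> s) ^ e * (norm h + norm u)"
      by (metis norm_mult norm_power norm_triangle_ineq4 mult_left_mono norm_ge_zero zero_le_power)
    have "norm u < \<epsilon>"
    proof (rule ccontr)
      assume "\<not> norm u < \<epsilon>"
      then have ge: "norm u \<ge> \<epsilon>" by simp
      have pos: "norm u > 0" using ge \<epsilon> by linarith
      have "norm h \<le> norm h / \<epsilon> * norm u"
        using mult_left_mono[OF ge, of "norm h"] \<epsilon> by (simp add: field_simps)
      then have "norm h + norm u \<le> norm u * C"
        by (simp add: C_def algebra_simps)
      then have "norm u ^ j * norm (Q (w s)) \<le> norm (\<zeta> s) ^ e * (norm u * C)"
        using nrm by (meson mult_left_mono norm_ge_zero order_trans zero_le_power)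
      moreover have "norm u ^ j = norm u * norm u ^ (j - 1)"
        using j(1) by (cases j) auto
      ultimately have "norm u * (norm (Q (w s)) * norm u ^ (j - 1)) \<le> norm u * (norm (\<zeta> s) ^ e * C)"
        by (simp add: mult_ac)
      then have "norm (Q (w s)) * norm u ^ (j - 1) \<le> norm (\<zeta> s) ^ e * C"
        using pos by simp
      moreover have "norm (Q (w s)) * \<epsilon> ^ (j - 1) \<le> norm (Q (w s)) * norm u ^ (j - 1)"
        using ge \<epsilon> by (intro mult_left_mono power_mono) auto
      ultimately show False
        using elim(3) by linarith
    qed
    then show ?case by (simp add: u_def)
  qed
qed

text \<open>On the curve this is \<open>- Z\<^sup>2 (x H\<^sub>x + y H\<^sub>y)\<close> with \<open>x = X / Z\<close> and \<open>y = Y / Z\<close>.\<close>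

definition euler_denom :: "nat \<Rightarrow> complex \<Rightarrow> complex \<Rightarrow> complex \<Rightarrow> complex \<Rightarrow> complex" where
  "euler_denom n h x y z = (of_nat n - 1) * x * y - (of_nat n + 1) * h * z ^ 2"

text \<open>In the chart \<open>X \<noteq> 0\<close> the form is \<open>dw / ((n - 1) w - (n + 1) h \<zeta>\<^sup>2)\<close>. Either \<open>w\<close> has a nonzero
  value at the point, and so does the denominator, or \<open>w = \<zeta>\<^sup>2 u\<close> with \<open>u\<close> vanishing there, and
  \<open>\<zeta>\<^sup>2\<close> cancels. The last two conclusions are needed to see that \<open>H\<^sub>y\<close> does not vanish on the
  branch.\<close>

lemma euler_form_analytic:
  assumes n: "n \<ge> 2" and h: "h \<noteq> 0" and j: "a j \<noteq> 0" "2 * j < n + 1"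
    and germ: "curve_germ n a h X Y Z" and X0: "X 0 \<noteq> 0"
  obtains g where "g analytic_on {0}"
    "\<forall>\<^sub>F s in at 0. (X s * deriv Y s - Y s * deriv X s) / euler_denom n h (X s) (Y s) (Z s) = g s"
    "\<forall>\<^sub>F s in at 0. euler_denom n h (X s) (Y s) (Z s) \<noteq> 0"
    "\<forall>\<^sub>F s in at 0. Y s \<noteq> 0"
    "Y 0 = 0 \<longrightarrow> ((\<lambda>s. X s * Y s / Z s ^ 2) \<longlongrightarrow> 0) (at 0)"
proof (cases "Y 0 = 0")
  case False
  have an: "X analytic_on {0}" "Y analytic_on {0}" "Z analytic_on {0}" "Z 0 = 0"
    using germ by (auto simp: curve_germ_def)
  let ?D = "\<lambda>s. euler_denom n h (X s) (Y s) (Z s)"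
  have D: "?D analytic_on {0}"
    unfolding euler_denom_def by (intro analytic_intros an)
  have "of_nat n \<noteq> (1 :: complex)"
    using n of_nat_eq_iff[of n 1, where 'a = complex] by simp
  then have D0: "?D 0 \<noteq> 0"
    using X0 False an by (simp add: euler_denom_def)
  show thesis
  proof (rule that)
    show "(\<lambda>s. (X s * deriv Y s - Y s * deriv X s) / ?D s) analytic_on {0}"
      using D0 by (intro analytic_intros an D) auto
    show "\<forall>\<^sub>F s in at 0. ?D s \<noteq> 0"
      using D D0 by (rule analytic_at_neq_imp_eventually_neq)
    show "\<forall>\<^sub>F s in at 0. Y s \<noteq> 0"
      using an(2) False by (rule analytic_at_neq_imp_eventually_neq)
  qed (use False in auto)
next
  case True
  have an: "X analytic_on {0}" "Y analytic_on {0}" "Z analytic_on {0}" and Z0: "Z 0 = 0"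
    using germ by (auto simp: curve_germ_def)
  have Xnz: "\<forall>\<^sub>F s in nhds 0. X s \<noteq> 0"
    using an X0 analytic_at_neq_imp_eventually_neq[of X 0 0] by (simp add: eventually_nhds_conv_at)
  have Znz: "\<forall>\<^sub>F s in at 0. Z s \<noteq> 0"
    using germ_leaves_infinity[of n a j] n j germ X0 by simp
  define w \<zeta> where "w s = Y s / X s" and "\<zeta> s = Z s / X s" for s
  have wz: "w analytic_on {0}" "\<zeta> analytic_on {0}" "w 0 = 0" "\<zeta> 0 = 0"
    unfolding w_def \<zeta>_def using an X0 Z0 True by (auto intro!: analytic_intros)
  have wlim: "(w \<longlongrightarrow> 0) (at 0)" and zlim: "(\<zeta> \<longlongrightarrow> 0) (at 0)"
    using wz isContD[OF analytic_at_imp_isCont] by metis+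
  have \<zeta>nz: "\<forall>\<^sub>F s in at 0. \<zeta> s \<noteq> 0"
    using Znz eventually_at_of_nhds[OF Xnz] by eventually_elim (simp add: \<zeta>_def)
  obtain r where r: "r > 0" "\<And>s. s \<in> ball 0 r \<Longrightarrow> proj_poly n a h (X s) (Y s) (Z s) = 0"
    using germ unfolding curve_germ_def by auto
  have "\<forall>\<^sub>F s in nhds 0. s \<in> ball 0 r"
    using r by (intro eventually_nhds_in_open) auto
  with Xnz have eq: "\<forall>\<^sub>F s in nhds 0. proj_poly n a h 1 (w s) (\<zeta> s) = 0"
    by eventually_elim (use r n in \<open>auto simp: w_def \<zeta>_def intro!: dehomogenize\<close>)
  have a0: "a 0 = 0"
    using eventually_nhds_x_imp_x[OF eq] wz n by (simp add: proj_poly_def Hom_one_zero)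
  \<comment> \<open>The given index only bounds the least one, which still satisfies \<open>2 * i < n + 1\<close>.\<close>
  define i where "i = (LEAST i. a i \<noteq> 0)"
  have i: "a i \<noteq> 0" "i \<le> j" "\<And>l. l < i \<Longrightarrow> a l = 0"
    unfolding i_def using j LeastI[of "\<lambda>i. a i \<noteq> 0" j] Least_le[of "\<lambda>i. a i \<noteq> 0" j] not_less_Least
    by blast+
  have ipos: "0 < i"
    using i(1) a0 by (cases i) auto
  have eq': "\<forall>\<^sub>F s in at 0. \<zeta> s ^ (n - 1) * w s + Hom n a 1 (w s) = h * \<zeta> s ^ (n + 1)"
    using eventually_at_of_nhds[OF eq] by eventually_elim (simp add: proj_poly_def)
  have lim: "((\<lambda>s. w s / \<zeta> s ^ 2) \<longlongrightarrow> 0) (at 0)"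
    by (rule quotient_by_square_tendsto_0[of _ _ _ n a h i]) (use i ipos j wlim zlim \<zeta>nz eq' in auto)
  define u where "u s = (if s = 0 then 0 else w s / \<zeta> s ^ 2)" for s
  have u: "u analytic_on {0}"
    unfolding u_def using lim wz
    by (intro removable_singularity' singularity_intros)
      (auto intro!: isolated_singularity_at_analytic not_essential_analytic analytic_intros)
  have u0: "u 0 = 0" by (simp add: u_def)
  have "\<forall>\<^sub>F s in at 0. w s = \<zeta> s ^ 2 * u s"
    using \<zeta>nz eventually_neq_at_within[of 0 0 UNIV] by eventually_elim (simp add: u_def)
  then have weq: "\<forall>\<^sub>F s in nhds 0. w s = \<zeta> s ^ 2 * u s"
    using wz by (simp add: eventually_nhds_conv_at)
  obtain L where L: "L analytic_on {0}" "\<forall>\<^sub>F s in at 0. deriv \<zeta> s / \<zeta> s * u s = L s"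
    using times_log_deriv_analytic[OF wz(2) \<zeta>nz u u0] by metis
  let ?d = "\<lambda>s. (of_nat n - 1) * u s - (of_nat n + 1) * h"
  have d: "?d analytic_on {0}"
    by (intro analytic_intros u)
  have "of_nat (Suc n) \<noteq> (0 :: complex)"
    by (rule of_nat_neq_0)
  then have d0: "?d 0 \<noteq> 0"
    using h u0 by (simp add: add.commute)
  have dnz: "\<forall>\<^sub>F s in at 0. ?d s \<noteq> 0"
    using analytic_at_neq_imp_eventually_neq[OF d d0] .
  note near = eventually_analytic_at[OF an(1)] eventually_analytic_at[OF an(2)]
    eventually_analytic_at[OF wz(2)] eventually_analytic_at[OF u] Xnz weq
  have dw: "\<forall>\<^sub>F s in nhds 0. X s * deriv Y s - Y s * deriv X s
      = X s ^ 2 * (2 * \<zeta> s * deriv \<zeta> s * u s + \<zeta> s ^ 2 * deriv u s)"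
    using near weq[THEN eventually_eventually[THEN iffD2]]
  proof eventually_elim
    case (elim s)
    have "(w has_field_derivative (deriv Y s * X s - Y s * deriv X s) / (X s * X s)) (at s)"
      unfolding w_def using elim by (intro DERIV_divide analytic_derivI)
    then have 1: "deriv w s = (deriv Y s * X s - Y s * deriv X s) / (X s * X s)"
      by (rule DERIV_imp_deriv)
    have "((\<lambda>s. \<zeta> s ^ 2 * u s) has_field_derivative
        (2 * \<zeta> s * deriv \<zeta> s * u s + \<zeta> s ^ 2 * deriv u s)) (at s)"
      using elim by (auto intro!: derivative_eq_intros analytic_derivI)
    then have "deriv (\<lambda>s. \<zeta> s ^ 2 * u s) s = 2 * \<zeta> s * deriv \<zeta> s * u s + \<zeta> s ^ 2 * deriv u s"
      by (rule DERIV_imp_deriv)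
    moreover have "deriv w s = deriv (\<lambda>s. \<zeta> s ^ 2 * u s) s"
      using elim by (intro deriv_cong_ev) auto
    ultimately show ?case
      using 1 elim(5) by (simp add: field_simps power2_eq_square)
  qed
  have D: "\<forall>\<^sub>F s in at 0. euler_denom n h (X s) (Y s) (Z s) = X s ^ 2 * \<zeta> s ^ 2 * ?d s"
    using eventually_at_of_nhds[OF Xnz] eventually_at_of_nhds[OF weq]
  proof eventually_elim
    case (elim s)
    have "Y s = X s * w s" "Z s = X s * \<zeta> s"
      using elim(1) by (simp_all add: w_def \<zeta>_def)
    then have "Y s = X s * (\<zeta> s ^ 2 * u s)" "Z s = X s * \<zeta> s"
      using elim(2) by simp_all
    then show ?case
      by (simp add: euler_denom_def power2_eq_square algebra_simps)
  qed
  show thesis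
  proof (rule that)
    show "(\<lambda>s. (2 * L s + deriv u s) / ?d s) analytic_on {0}"
      using d0 by (intro analytic_intros L u d) auto
    show "\<forall>\<^sub>F s in at 0. (X s * deriv Y s - Y s * deriv X s) / euler_denom n h (X s) (Y s) (Z s)
        = (2 * L s + deriv u s) / ?d s"
      using eventually_at_of_nhds[OF dw] D L(2) \<zeta>nz eventually_at_of_nhds[OF Xnz] dnz
    proof eventually_elim
      case (elim s)
      have "2 * \<zeta> s * deriv \<zeta> s * u s + \<zeta> s ^ 2 * deriv u s = \<zeta> s ^ 2 * (2 * L s + deriv u s)"
        unfolding elim(3)[symmetric] using elim(4) by (simp add: field_simps power2_eq_square)
      then have "X s * deriv Y s - Y s * deriv X s = X s ^ 2 * \<zeta> s ^ 2 * (2 * L s + deriv u s)"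
        using elim(1) by (simp add: mult.assoc)
      then show ?case
        unfolding elim(2) using elim(4,5) by simp
    qed
    show "\<forall>\<^sub>F s in at 0. euler_denom n h (X s) (Y s) (Z s) \<noteq> 0"
      using D \<zeta>nz eventually_at_of_nhds[OF Xnz] dnz by eventually_elim simp
    show "\<forall>\<^sub>F s in at 0. Y s \<noteq> 0"
      using eq' \<zeta>nz
    proof eventually_elim
      case (elim s)
      then show ?case
        using h a0 by (auto simp: w_def Hom_one_zero)
    qed
    have "\<forall>\<^sub>F s in at 0. w s / \<zeta> s ^ 2 = X s * Y s / Z s ^ 2"
      using eventually_at_of_nhds[OF Xnz]
      by eventually_elim (simp add: w_def \<zeta>_def power2_eq_square)
    with lim have "((\<lambda>s. X s * Y s / Z s ^ 2) \<longlongrightarrow> 0) (at 0)"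
      by (rule Lim_transform_eventually)
    then show "Y 0 = 0 \<longrightarrow> ((\<lambda>s. X s * Y s / Z s ^ 2) \<longlongrightarrow> 0) (at 0)" ..
  qed
qed

text \<open>A point with \<open>X = 0\<close> is brought into the chart by exchanging \<open>X\<close> and \<open>Y\<close>, which reverses the
  coefficient sequence and the sign of the form; an index above \<open>(n + 1) / 2\<close> becomes one below.\<close>

lemma euler_form_analytic_at_infinity:
  assumes n: "n \<ge> 2" and h: "h \<noteq> 0"
    and jk: "a j \<noteq> 0" "2 * j < n + 1" "a k \<noteq> 0" "n + 1 < 2 * k" "k \<le> n + 1"
    and germ: "curve_germ n a h X Y Z"
  obtains g where "g analytic_on {0}"
    "\<forall>\<^sub>F s in at 0. (X s * deriv Y s - Y s * deriv X s) / euler_denom n h (X s) (Y s) (Z s) = g s"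
    "\<forall>\<^sub>F s in at 0. euler_denom n h (X s) (Y s) (Z s) \<noteq> 0"
    "\<forall>\<^sub>F s in at 0. Z s \<noteq> 0" "\<forall>\<^sub>F s in at 0. X s \<noteq> 0"
    "X 0 = 0 \<longrightarrow> ((\<lambda>s. X s * Y s / Z s ^ 2) \<longlongrightarrow> 0) (at 0)"
proof (cases "X 0 = 0")
  case False
  have "\<forall>\<^sub>F s in at 0. X s \<noteq> 0"
    using germ False analytic_at_neq_imp_eventually_neq[of X 0 0] by (simp add: curve_germ_def)
  moreover have "\<forall>\<^sub>F s in at 0. Z s \<noteq> 0"
    using germ_leaves_infinity[of n a j] n jk germ False by simp
  moreover obtain g where "g analytic_on {0}"
    "\<forall>\<^sub>F s in at 0. (X s * deriv Y s - Y s * deriv X s) / euler_denom n h (X s) (Y s) (Z s) = g s"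
    "\<forall>\<^sub>F s in at 0. euler_denom n h (X s) (Y s) (Z s) \<noteq> 0"
    "\<forall>\<^sub>F s in at 0. Y s \<noteq> 0"
    "Y 0 = 0 \<longrightarrow> ((\<lambda>s. X s * Y s / Z s ^ 2) \<longlongrightarrow> 0) (at 0)"
    by (rule euler_form_analytic[OF n h jk(1,2) germ False])
  ultimately show thesis
    using that[of g] False by simp
next
  case True
  let ?a = "\<lambda>i. a (n + 1 - i)"
  have germ': "curve_germ n ?a h Y X Z"
    using germ by (rule curve_germ_swap)
  have k': "?a (n + 1 - k) \<noteq> 0" "2 * (n + 1 - k) < n + 1"
    using jk by auto
  have Y0: "Y 0 \<noteq> 0"
    using germ True by (simp add: curve_germ_def)
  obtain g where g: "g analytic_on {0}"
    "\<forall>\<^sub>F s in at 0. (Y s * deriv X s - X s * deriv Y s) / euler_denom n h (Y s) (X s) (Z s) = g s"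
    "\<forall>\<^sub>F s in at 0. euler_denom n h (Y s) (X s) (Z s) \<noteq> 0"
    "\<forall>\<^sub>F s in at 0. X s \<noteq> 0"
    "X 0 = 0 \<longrightarrow> ((\<lambda>s. Y s * X s / Z s ^ 2) \<longlongrightarrow> 0) (at 0)"
    by (rule euler_form_analytic[OF n h k' germ' Y0])
  have D: "euler_denom n h y x z = euler_denom n h x y z" for x y z
    by (simp add: euler_denom_def mult_ac)
  show thesis
  proof (rule that)
    show "(\<lambda>s. - g s) analytic_on {0}"
      using g(1) by (intro analytic_intros)
    show "\<forall>\<^sub>F s in at 0. (X s * deriv Y s - Y s * deriv X s) / euler_denom n h (X s) (Y s) (Z s) = - g s"
      using g(2)
    proof eventually_elim
      case (elim s)
      have "X s * deriv Y s - Y s * deriv X s = - (Y s * deriv X s - X s * deriv Y s)"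
        by simp
      then show ?case
        unfolding elim[symmetric] D[of "X s" "Y s"] by (simp only: minus_divide_left)
    qed
    show "\<forall>\<^sub>F s in at 0. euler_denom n h (X s) (Y s) (Z s) \<noteq> 0"
      using g(3) by eventually_elim (metis D)
    show "\<forall>\<^sub>F s in at 0. Z s \<noteq> 0"
      using germ_leaves_infinity[of n ?a "n + 1 - k", OF n _ _ germ' Y0] k' by simp
    show "X 0 = 0 \<longrightarrow> ((\<lambda>s. X s * Y s / Z s ^ 2) \<longlongrightarrow> 0) (at 0)"
      using g(5) by (simp add: mult.commute)
  qed (fact g(4))
qed

section \<open>Derivatives of the Hamiltonian\<close>

definition Hom_x :: "nat \<Rightarrow> (nat \<Rightarrow> complex) \<Rightarrow> complex \<Rightarrow> complex \<Rightarrow> complex" where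
  "Hom_x n a x y = (\<Sum>j=0..n+1. a j * (of_nat (n + 1 - j) * x ^ (n + 1 - j - 1)) * y ^ j)"

definition Hom_y :: "nat \<Rightarrow> (nat \<Rightarrow> complex) \<Rightarrow> complex \<Rightarrow> complex \<Rightarrow> complex" where
  "Hom_y n a x y = (\<Sum>j=0..n+1. a j * x ^ (n + 1 - j) * (of_nat j * y ^ (j - 1)))"

lemma Hom_has_derivative:
  assumes "(x has_field_derivative x') (at s)" "(y has_field_derivative y') (at s)"
  shows "((\<lambda>s. Hom n a (x s) (y s)) has_field_derivative
    (Hom_x n a (x s) (y s) * x' + Hom_y n a (x s) (y s) * y')) (at s)"
proof -
  have "((\<lambda>s. a j * x s ^ (n + 1 - j) * y s ^ j) has_field_derivative
      (a j * (of_nat (n + 1 - j) * x s ^ (n + 1 - j - 1)) * y s ^ j * x' +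
       a j * x s ^ (n + 1 - j) * (of_nat j * y s ^ (j - 1)) * y')) (at s)" for j
    by (rule derivative_eq_intros assms refl)+ (simp add: algebra_simps)
  then have "((\<lambda>s. \<Sum>j=0..n+1. a j * x s ^ (n + 1 - j) * y s ^ j) has_field_derivative
      (\<Sum>j=0..n+1. a j * (of_nat (n + 1 - j) * x s ^ (n + 1 - j - 1)) * y s ^ j * x' +
       a j * x s ^ (n + 1 - j) * (of_nat j * y s ^ (j - 1)) * y')) (at s)"
    by (intro DERIV_sum)
  then show ?thesis
    unfolding Hom_def Hom_x_def Hom_y_def sum_distrib_right sum.distrib .
qed

lemma Ham_y_eq: "Ham_y n a x y = x + Hom_y n a x y"
proof -
  have "((\<lambda>v. Hom n a x v) has_field_derivative (Hom_x n a x y * 0 + Hom_y n a x y * 1)) (at y)"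
    by (intro Hom_has_derivative derivative_intros)
  then have "((\<lambda>v. Ham n a x v) has_field_derivative (x + Hom_y n a x y)) (at y)"
    unfolding Ham_def by (auto intro!: derivative_eq_intros)
  then show ?thesis
    unfolding Ham_y_def by (rule DERIV_imp_deriv)
qed

lemma Hom_euler: "x * Hom_x n a x y + y * Hom_y n a x y = (of_nat n + 1) * Hom n a x y"
  unfolding Hom_def Hom_x_def Hom_y_def sum_distrib_left sum.distrib[symmetric]
proof (rule sum.cong)
  fix j assume j: "j \<in> {0..n+1}"
  have pow: "v * (of_nat m * v ^ (m - 1)) = of_nat m * v ^ m" for v :: complex and m
    by (cases m) auto
  have "x * (a j * (of_nat (n + 1 - j) * x ^ (n + 1 - j - 1)) * y ^ j) +
      y * (a j * x ^ (n + 1 - j) * (of_nat j * y ^ (j - 1)))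
    = a j * (x * (of_nat (n + 1 - j) * x ^ (n + 1 - j - 1))) * y ^ j +
      a j * x ^ (n + 1 - j) * (y * (of_nat j * y ^ (j - 1)))"
    by (simp add: mult_ac)
  also have "\<dots> = of_nat (n + 1 - j + j) * (a j * x ^ (n + 1 - j) * y ^ j)"
    unfolding pow of_nat_add by (simp add: algebra_simps)
  also have "n + 1 - j + j = n + 1"
    using j by simp
  finally show "x * (a j * (of_nat (n + 1 - j) * x ^ (n + 1 - j - 1)) * y ^ j) +
      y * (a j * x ^ (n + 1 - j) * (of_nat j * y ^ (j - 1)))
    = (of_nat n + 1) * (a j * x ^ (n + 1 - j) * y ^ j)"
    by (simp add: add.commute)
qed simp

lemma Hom_y_scale: "Hom_y n a (c * x) (c * y) = c ^ n * Hom_y n a x y"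
  unfolding Hom_y_def sum_distrib_left
proof (rule sum.cong)
  fix j assume j: "j \<in> {0..n+1}"
  show "a j * (c * x) ^ (n + 1 - j) * (of_nat j * (c * y) ^ (j - 1))
      = c ^ n * (a j * x ^ (n + 1 - j) * (of_nat j * y ^ (j - 1)))"
  proof (cases j)
    case (Suc m)
    then have "c ^ n = c ^ (n + 1 - j) * c ^ (j - 1)"
      using j by (simp flip: power_add)
    then show ?thesis
      by (simp add: power_mult_distrib mult_ac)
  qed simp
qed simp

text \<open>Differentiating \<open>H = h\<close> eliminates \<open>H\<^sub>x\<close>, Euler's identity eliminates the homogeneous part;
  what is left expresses \<open>dx / H\<^sub>y\<close> without derivatives of \<open>H\<close>. The identity involves no division
  by \<open>H\<^sub>y\<close>, so that it also has content where \<open>H\<^sub>y\<close> vanishes.\<close>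

lemma Ham_y_times_wronskian:
  assumes n: "n \<ge> 2" and germ: "curve_germ n a h X Y Z" and Znz: "\<forall>\<^sub>F s in at 0. Z s \<noteq> 0"
  defines "x \<equiv> \<lambda>s. X s / Z s" and "y \<equiv> \<lambda>s. Y s / Z s"
  shows "\<forall>\<^sub>F s in at 0. x analytic_on {s} \<and>
    Ham_y n a (x s) (y s) * (X s * deriv Y s - Y s * deriv X s)
      = deriv x s * euler_denom n h (X s) (Y s) (Z s)"
proof -
  have an: "X analytic_on {0}" "Y analytic_on {0}" "Z analytic_on {0}"
    using germ by (auto simp: curve_germ_def)
  obtain r where r: "r > 0" "\<And>s. s \<in> ball 0 r \<Longrightarrow> proj_poly n a h (X s) (Y s) (Z s) = 0"
    using germ unfolding curve_germ_def by auto
  have "\<forall>\<^sub>F s in nhds 0. s \<in> ball 0 r"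
    using r by (intro eventually_nhds_in_open) auto
  from eventually_at_of_nhds[OF this] Znz
  have lev: "\<forall>\<^sub>F s in at 0. x s * y s + Hom n a (x s) (y s) = h"
  proof eventually_elim
    case (elim s)
    have "proj_poly n a h (Z s * x s) (Z s * y s) (Z s * 1) = 0"
      using r(2)[of s] elim by (simp add: x_def y_def)
    then have "proj_poly n a h (x s) (y s) 1 = 0"
      using elim(2) n by (subst (asm) proj_poly_scale) auto
    then show ?case
      by (simp add: proj_poly_def)
  qed
  have lev': "\<forall>\<^sub>F s in at 0. \<forall>\<^sub>F t in nhds s. x t * y t + Hom n a (x t) (y t) = h"
    using lev by (rule eventually_at_eventually_nhds)
  show ?thesis
    using Znz lev lev' eventually_at_of_nhds[OF eventually_analytic_at[OF an(1)]]
      eventually_at_of_nhds[OF eventually_analytic_at[OF an(2)]]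
      eventually_at_of_nhds[OF eventually_analytic_at[OF an(3)]]
  proof eventually_elim
    case (elim s)
    have xan: "x analytic_on {s}" and yan: "y analytic_on {s}"
      unfolding x_def y_def using elim by (auto intro!: analytic_intros)
    have "(x has_field_derivative (deriv X s * Z s - X s * deriv Z s) / (Z s * Z s)) (at s)"
      "(y has_field_derivative (deriv Y s * Z s - Y s * deriv Z s) / (Z s * Z s)) (at s)"
      unfolding x_def y_def using elim by (auto intro!: DERIV_divide analytic_derivI)
    then have d: "deriv x s = (deriv X s * Z s - X s * deriv Z s) / (Z s * Z s)"
      "deriv y s = (deriv Y s * Z s - Y s * deriv Z s) / (Z s * Z s)"
      by (auto intro: DERIV_imp_deriv)
    have wr: "x s * deriv y s - y s * deriv x s = (X s * deriv Y s - Y s * deriv X s) / Z s ^ 2"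
      unfolding d using elim(1) by (simp add: x_def y_def field_simps power2_eq_square)
    note xd = analytic_derivI[OF xan, of UNIV] and yd = analytic_derivI[OF yan, of UNIV]
    define Hx Hy where "Hx = y s + Hom_x n a (x s) (y s)" and "Hy = x s + Hom_y n a (x s) (y s)"
    have "((\<lambda>t. x t * y t + Hom n a (x t) (y t)) has_field_derivative
        (Hx * deriv x s + Hy * deriv y s)) (at s)"
      unfolding Hx_def Hy_def
      by (rule derivative_eq_intros Hom_has_derivative xd yd refl)+ (simp add: algebra_simps)
    moreover have "((\<lambda>t. x t * y t + Hom n a (x t) (y t)) has_field_derivative 0) (at s)
      \<longleftrightarrow> ((\<lambda>t. h) has_field_derivative 0) (at s)"
      using elim(3) by (intro DERIV_cong_ev) auto
    ultimately have 1: "Hx * deriv x s + Hy * deriv y s = 0"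
      using DERIV_unique by fastforce
    have "x s * Hx + y s * Hy = 2 * (x s * y s) + (of_nat n + 1) * Hom n a (x s) (y s)"
      unfolding Hx_def Hy_def using Hom_euler[of "x s" n a "y s"] by (simp add: algebra_simps)
    also have "Hom n a (x s) (y s) = h - x s * y s"
      using elim(2) by (simp add: algebra_simps)
    finally have 2: "(of_nat n - 1) * x s * y s - (of_nat n + 1) * h = - (x s * Hx + y s * Hy)"
      by (simp add: algebra_simps)
    have "Hy * (x s * deriv y s - y s * deriv x s) = x s * (Hy * deriv y s) - deriv x s * y s * Hy"
      by (simp add: algebra_simps)
    also have "Hy * deriv y s = - Hx * deriv x s"
      using 1 by (simp add: add_eq_0_iff)
    also have "x s * (- Hx * deriv x s) - deriv x s * y s * Hy
        = deriv x s * ((of_nat n - 1) * x s * y s - (of_nat n + 1) * h)"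
      unfolding 2 by (simp add: algebra_simps)
    finally have "Hy * (X s * deriv Y s - Y s * deriv X s)
        = deriv x s * (Z s ^ 2 * ((of_nat n - 1) * x s * y s - (of_nat n + 1) * h))"
      unfolding wr using elim(1) by (simp add: field_simps)
    also have "Z s ^ 2 * ((of_nat n - 1) * x s * y s - (of_nat n + 1) * h)
        = euler_denom n h (X s) (Y s) (Z s)"
      using elim(1) by (simp add: euler_denom_def x_def y_def field_simps power2_eq_square)
    finally show ?case
      using xan by (simp add: Ham_y_eq Hy_def)
  qed
qed

text \<open>\<open>H\<^sub>y\<close> becomes analytic after multiplication by \<open>Z\<^sup>n\<close>, so it vanishes either nowhere in a
  punctured neighbourhood of the point or identically. In the second case \<open>x\<close> is a constant \<open>c \<noteq> 0\<close>; then \<open>X = c Z\<close> puts the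
  branch at \<open>[0:1:0]\<close>, and \<open>Y = (X Y / Z\<^sup>2) (Z / c)\<close> tends to \<open>0\<close>, which is impossible there.\<close>

lemma Ham_y_nonzero_on_germ:
  assumes n: "n \<ge> 2" and germ: "curve_germ n a h X Y Z"
    and D: "\<forall>\<^sub>F s in at 0. euler_denom n h (X s) (Y s) (Z s) \<noteq> 0"
    and Znz: "\<forall>\<^sub>F s in at 0. Z s \<noteq> 0" and Xnz: "\<forall>\<^sub>F s in at 0. X s \<noteq> 0"
    and lim: "X 0 = 0 \<longrightarrow> ((\<lambda>s. X s * Y s / Z s ^ 2) \<longlongrightarrow> 0) (at 0)"
  shows "\<forall>\<^sub>F s in at 0. Ham_y n a (X s / Z s) (Y s / Z s) \<noteq> 0"
proof -
  have an: "X analytic_on {0}" "Y analytic_on {0}" "Z analytic_on {0}" and Z0: "Z 0 = 0"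
    using germ by (auto simp: curve_germ_def)
  note lims = an[THEN analytic_at_imp_isCont, THEN isContD]
  define K where "K s = Z s ^ (n - 1) * X s + Hom_y n a (X s) (Y s)" for s
  have K: "\<forall>\<^sub>F s in at 0. K s = Z s ^ n * Ham_y n a (X s / Z s) (Y s / Z s)"
    using Znz
  proof eventually_elim
    case (elim s)
    have "Z s ^ (n - 1) * X s = Z s ^ n * (X s / Z s)"
      using elim n by (cases n) auto
    moreover have "Hom_y n a (X s) (Y s) = Z s ^ n * Hom_y n a (X s / Z s) (Y s / Z s)"
      using Hom_y_scale[of n a "Z s" "X s / Z s" "Y s / Z s"] elim by simp
    ultimately show ?case
      unfolding K_def Ham_y_eq by (simp only: distrib_left)
  qed
  have "K analytic_on {0}"
    unfolding K_def Hom_y_def by (intro analytic_intros an)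
  then consider "\<forall>\<^sub>F s in at 0. K s \<noteq> 0" | "\<forall>\<^sub>F s in at 0. K s = 0"
    using analytic_zero_or_nonzero by blast
  then show ?thesis
  proof cases
    case 1
    then show ?thesis
      using K by eventually_elim auto
  next
    case 2
    have "\<forall>\<^sub>F s in at 0. (\<lambda>s. X s / Z s) analytic_on {s} \<and> deriv (\<lambda>s. X s / Z s) s = 0"
      using 2 K Znz D Ham_y_times_wronskian[OF n germ Znz]
      by eventually_elim auto
    then obtain c where c: "\<forall>\<^sub>F s in at 0. X s / Z s = c"
      by (rule eventually_deriv_zero_imp_constant)
    have Xc: "\<forall>\<^sub>F s in at 0. X s = c * Z s"
      using c Znz by eventually_elim (auto simp: field_simps)
    have "\<forall>\<^sub>F s in at 0. X s = c * Z s \<and> X s \<noteq> 0"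
      using Xc Xnz by (rule eventually_conj)
    then have c0: "c \<noteq> 0"
      using eventually_happens'[OF trivial_limit_at] by force
    have "((\<lambda>s. c * Z s) \<longlongrightarrow> c * Z 0) (at 0)"
      by (intro tendsto_intros lims)
    then have "(X \<longlongrightarrow> c * Z 0) (at 0)"
      by (rule Lim_transform_eventually) (use Xc in \<open>auto elim: eventually_mono\<close>)
    then have X0: "X 0 = 0"
      using lims(1) tendsto_unique[of "at 0" X] Z0 by fastforce
    have "((\<lambda>s. X s * Y s / Z s ^ 2 * (Z s / c)) \<longlongrightarrow> 0 * (Z 0 / c)) (at 0)"
      by (intro tendsto_intros lims lim[rule_format, OF X0] c0)
    moreover have "\<forall>\<^sub>F s in at 0. X s * Y s / Z s ^ 2 * (Z s / c) = Y s"
      using Xc Znz by eventually_elim (use c0 in \<open>simp add: power2_eq_square\<close>)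
    ultimately have "(Y \<longlongrightarrow> 0 * (Z 0 / c)) (at 0)"
      by (rule Lim_transform_eventually)
    then have "Y 0 = 0"
      using lims(2) tendsto_unique[of "at 0" Y] by fastforce
    then show ?thesis
      using germ X0 by (simp add: curve_germ_def)
  qed
qed

theorem theorem4:
  fixes n :: nat and a :: "nat \<Rightarrow> complex"
  assumes "n \<ge> 2"
    and "\<exists>j k. real j < (real n + 1) / 2 \<and> (real n + 1) / 2 < real k \<and> k \<le> n + 1 \<and> a j * a k \<noteq> 0"
  shows "\<forall>h. h \<noteq> 0 \<longrightarrow> no_pole_at_infinity (Ham_y n a) (proj_closure n a h)"
proof (intro allI impI)
  fix h :: complex assume h: "h \<noteq> 0"
  obtain j k where jk: "a j \<noteq> 0" "2 * j < n + 1" "a k \<noteq> 0" "n + 1 < 2 * k" "k \<le> n + 1"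
  proof -
    obtain j k where "real j < (real n + 1) / 2" "(real n + 1) / 2 < real k" "k \<le> n + 1"
      "a j * a k \<noteq> 0"
      using assms(2) by blast
    then show thesis
      by (intro that[of j k]) (auto simp: field_simps)
  qed
  show "no_pole_at_infinity (Ham_y n a) (proj_closure n a h)"
    unfolding no_pole_at_infinity_def
  proof (intro ballI allI impI)
    fix P X Y Z
    assume P: "P \<in> points_at_infinity (proj_closure n a h)"
      "branch_param (proj_closure n a h) P X Y Z"
    have germ: "curve_germ n a h X Y Z"
      using branch_param_curve_germ[OF _ P] assms(1) by simp
    obtain g where g: "g analytic_on {0}"
      "\<forall>\<^sub>F s in at 0. (X s * deriv Y s - Y s * deriv X s) / euler_denom n h (X s) (Y s) (Z s) = g s"
      and D: "\<forall>\<^sub>F s in at 0. euler_denom n h (X s) (Y s) (Z s) \<noteq> 0"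
      and Z: "\<forall>\<^sub>F s in at 0. Z s \<noteq> 0" and X: "\<forall>\<^sub>F s in at 0. X s \<noteq> 0"
      and lim: "X 0 = 0 \<longrightarrow> ((\<lambda>s. X s * Y s / Z s ^ 2) \<longlongrightarrow> 0) (at 0)"
      by (rule euler_form_analytic_at_infinity[OF assms(1) h jk germ])
    have "\<forall>\<^sub>F s in at 0. Ham_y n a (X s / Z s) (Y s / Z s) \<noteq> 0"
      by (rule Ham_y_nonzero_on_germ[OF assms(1) germ D Z X lim])
    then have "\<forall>\<^sub>F s in at 0. Ham_y n a (X s / Z s) (Y s / Z s) \<noteq> 0 \<and>
        deriv (\<lambda>s. X s / Z s) s / Ham_y n a (X s / Z s) (Y s / Z s) = g s"
      using g(2) D Ham_y_times_wronskian[OF assms(1) germ Z]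
    proof eventually_elim
      case (elim s)
      let ?H = "Ham_y n a (X s / Z s) (Y s / Z s)" and ?D = "euler_denom n h (X s) (Y s) (Z s)"
      have "deriv (\<lambda>s. X s / Z s) s / ?H = (X s * deriv Y s - Y s * deriv X s) / ?D"
        using elim(4) by (subst frac_eq_eq[OF elim(1,3)]) (simp add: mult.commute)
      then show ?case
        using elim(1,2) by simp
    qed
    then show "(\<forall>\<^sub>F s in at 0. Z s \<noteq> 0) \<and>
        dx_over_pullback_holomorphic (Ham_y n a) (\<lambda>s. X s / Z s) (\<lambda>s. Y s / Z s)"
      using Z g(1) unfolding dx_over_pullback_holomorphic_def by blast
  qed
qed

end
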